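(* Let $\mathcal{S}\subset \mathcal{LO}(\mathrm{Homeo}_+(\mathbb{R}))$ be the set of all standard dynamical-lexicographic orderings and let $\mathcal{T}$ be the set of all typical orderings on $\mathrm{Homeo}_+(\mathbb{R})$. Then the topological closure of $\mathcal{S}$ in $\mathcal{LO}(\mathrm{Homeo}_+(\mathbb{R}))$ is $\mathcal{T}$: $\overline{\mathcal{S}}=\mathcal{T}$.
   Context: $\mathrm{Homeo}_+(\mathbb{R})$ is the group (under composition) of orientation-preserving homeomorphisms of $\mathbb{R}$. A left-ordering on a group $G$ is a total order $\preceq$ on $G$ such that $f\prec g$ implies $hf\prec hg$ for all $f,g,h\in G$. $\mathcal{LO}(G)$ is the set of all left-orderings on $G$. For $S\subset G$, let $U_S$ be the set of left-orderings in which every element of $S$ is positive (strictly greater than the identity); $\mathcal{LO}(G)$ carries the topology with subbasis $\{U_S : S\subset G \text{ finite}\}$. Standard dynamical-lexicographic ordering: given a sequence $\mathbf{x}=(x_n)_{n=1}^\infty$ dense in $\mathbb{R}$ and $\Omega:\mathbb{N}\to\{+,-\}$, the ordering $\preceq_{\mathbf{x},\Omega}$ on $\mathrm{Homeo}_+(\mathbb{R})$ is defined, for $f\ne g$, by $f\succ g$ iff either $f(x_n)>g(x_n)$ and $\Omega(n)=+$, or $f(x_n)<g(x_n)$ and $\Omega(n)=-$, where $n$ is the smallest index with $f(x_n)\neq g(x_n)$. For $f\in\mathrm{Homeo}_+(\mathbb{R})$ put $A_f=\{x\in\mathbb{R}: f(x)>x\}$ and $B_f=\{x\in\mathbb{R}: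 f(x)<x\}$. A left-ordering $\preceq$ on $\mathrm{Homeo}_+(\mathbb{R})$ is typical if the sign of each element depends only on these sets: whenever $A_f=A_g$ and $B_f=B_g$, the elements $f$ and $g$ have the same sign (both positive, both negative, or both equal to the identity) with respect to $\preceq$. *)

theory Defs
  imports "HOL-Analysis.Analysis" "HOL-Algebra.Group"
begin

section \<open>The space of left-orderings of a group\<close>

text \<open>
  An ordering on \<open>G\<close> is represented by the relation of all pairs \<open>(f, g)\<close> of elements of
  \<open>carrier G\<close> with \<open>f \<preceq> g\<close>.
\<close>

definition strictly_below :: "'a rel \<Rightarrow> 'a \<Rightarrow> 'a \<Rightarrow> bool" where
  "strictly_below r f g \<longleftrightarrow> (f, g) \<in> r \<and> f \<noteq> g"

definition left_orderings :: "('a, 'm) monoid_scheme \<Rightarrow> 'a rel set" where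
  "left_orderings G =
     {r. linear_order_on (carrier G) r \<and>
         (\<forall>f\<in>carrier G. \<forall>g\<in>carrier G. \<forall>h\<in>carrier G.
            strictly_below r f g \<longrightarrow> strictly_below r (h \<otimes>\<^bsub>G\<^esub> f) (h \<otimes>\<^bsub>G\<^esub> g))}"

definition positive_elem :: "('a, 'm) monoid_scheme \<Rightarrow> 'a rel \<Rightarrow> 'a \<Rightarrow> bool" where
  "positive_elem G r f \<longleftrightarrow> strictly_below r \<one>\<^bsub>G\<^esub> f"

definition negative_elem :: "('a, 'm) monoid_scheme \<Rightarrow> 'a rel \<Rightarrow> 'a \<Rightarrow> bool" where
  "negative_elem G r f \<longleftrightarrow> strictly_below r f \<one>\<^bsub>G\<^esub>"

definition orderings_positive_on :: "('a, 'm) monoid_scheme \<Rightarrow> 'a set \<Rightarrow> 'a rel set" where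
  "orderings_positive_on G S = {r \<in> left_orderings G. \<forall>f\<in>S. positive_elem G r f}"

definition LO_topology :: "('a, 'm) monoid_scheme \<Rightarrow> 'a rel topology" where
  "LO_topology G =
     topology_generated_by {orderings_positive_on G S | S. S \<subseteq> carrier G \<and> finite S}"

lemma topspace_LO_topology [simp]: "topspace (LO_topology G) = left_orderings G"
proof -
  have "orderings_positive_on G {} = left_orderings G"
    by (simp add: orderings_positive_on_def)
  then have "left_orderings G \<subseteq> \<Union>{orderings_positive_on G S | S. S \<subseteq> carrier G \<and> finite S}"
    by (metis (mono_tags, lifting) Union_upper empty_subsetI finite.emptyI mem_Collect_eq)
  moreover have "orderings_positive_on G S \<subseteq> left_orderings G" for S
    by (auto simp: orderings_positive_on_def)
  ultimately show ?thesis
    unfolding LO_topology_def topology_generated_by_topspace by blast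
qed


section \<open>Orientation-preserving homeomorphisms of the line\<close>

definition Homeo_plus :: "(real \<Rightarrow> real) monoid" where
  "Homeo_plus =
     \<lparr>carrier = {f. (\<exists>g. homeomorphism UNIV UNIV f g) \<and> strict_mono f},
      monoid.mult = (\<circ>), one = id\<rparr>"

lemma carrier_Homeo_plus:
  "f \<in> carrier Homeo_plus \<longleftrightarrow> (\<exists>g. homeomorphism UNIV UNIV f g) \<and> strict_mono f"
  by (simp add: Homeo_plus_def)

lemma mult_Homeo_plus [simp]: "f \<otimes>\<^bsub>Homeo_plus\<^esub> g = f \<circ> g"
  by (simp add: Homeo_plus_def)

lemma one_Homeo_plus [simp]: "\<one>\<^bsub>Homeo_plus\<^esub> = id"
  by (simp add: Homeo_plus_def)

lemma group_Homeo_plus: "group Homeo_plus"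
proof (rule groupI)
  fix f g assume "f \<in> carrier Homeo_plus" "g \<in> carrier Homeo_plus"
  then show "f \<otimes>\<^bsub>Homeo_plus\<^esub> g \<in> carrier Homeo_plus"
    unfolding carrier_Homeo_plus mult_Homeo_plus
    by (meson homeomorphism_compose strict_mono_o)
next
  have "homeomorphism UNIV UNIV (id :: real \<Rightarrow> real) id"
    by (simp add: homeomorphism_def)
  then show "\<one>\<^bsub>Homeo_plus\<^esub> \<in> carrier Homeo_plus"
    by (auto simp: carrier_Homeo_plus strict_mono_def)
next
  fix f assume "f \<in> carrier Homeo_plus"
  then obtain g where g: "homeomorphism UNIV UNIV f g" and f: "strict_mono f"
    by (auto simp: carrier_Homeo_plus)
  have "strict_mono g"
  proof (rule strict_monoI)
    fix x y :: real assume "x < y"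
    moreover have "f (g x) = x" "f (g y) = y"
      using g by (auto simp: homeomorphism_def)
    ultimately show "g x < g y"
      using strict_mono_less[OF f, of "g x" "g y"] by simp
  qed
  moreover have "homeomorphism UNIV UNIV g f"
    using g by (simp add: homeomorphism_symD)
  moreover have "g \<circ> f = id"
    using g by (auto simp: homeomorphism_def fun_eq_iff)
  ultimately show "\<exists>g\<in>carrier Homeo_plus. g \<otimes>\<^bsub>Homeo_plus\<^esub> f = \<one>\<^bsub>Homeo_plus\<^esub>"
    by (intro bexI[of _ g]) (auto simp: carrier_Homeo_plus)
qed (auto simp: comp_assoc)


section \<open>Standard dynamical-lexicographic orderings\<close>

datatype order_sign = Positive | Negative

text \<open>Sequences are indexed from \<open>0\<close>.\<close>

definition dyn_lex_greater ::
    "(nat \<Rightarrow> real) \<Rightarrow> (nat \<Rightarrow> order_sign) \<Rightarrow> (real \<Rightarrow> real) \<Rightarrow> (real \<Rightarrow> real) \<Rightarrow> bool" where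
  "dyn_lex_greater x \<Omega> f g \<longleftrightarrow>
     f \<noteq> g \<and>
     (let n = (LEAST n. f (x n) \<noteq> g (x n)) in
        (f (x n) > g (x n) \<and> \<Omega> n = Positive) \<or> (f (x n) < g (x n) \<and> \<Omega> n = Negative))"

definition dyn_lex_ordering ::
    "(nat \<Rightarrow> real) \<Rightarrow> (nat \<Rightarrow> order_sign) \<Rightarrow> (real \<Rightarrow> real) rel" where
  "dyn_lex_ordering x \<Omega> =
     {(g, f). g \<in> carrier Homeo_plus \<and> f \<in> carrier Homeo_plus \<and>
              (f = g \<or> dyn_lex_greater x \<Omega> f g)}"

definition standard_dyn_lex_orderings :: "(real \<Rightarrow> real) rel set" where
  "standard_dyn_lex_orderings =
     {dyn_lex_ordering x \<Omega> | x \<Omega>. closure (range x) = UNIV}"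

lemma Homeo_plus_eq_on_dense:
  assumes "f \<in> carrier Homeo_plus" "g \<in> carrier Homeo_plus"
    and "closure (range x) = UNIV" "\<And>n. f (x n) = g (x n)"
  shows "f = g"
proof -
  have "continuous_on UNIV f" "continuous_on UNIV g"
    using assms by (auto simp: carrier_Homeo_plus homeomorphism_def)
  then have "closed {y. f y = g y}"
    by (rule closed_Collect_eq)
  then have "closure (range x) \<subseteq> {y. f y = g y}"
    using assms(4) by (intro closure_minimal) auto
  with assms(3) show ?thesis by auto
qed

lemma dyn_lex_greater_alt:
  assumes "f \<in> carrier Homeo_plus" "g \<in> carrier Homeo_plus" "closure (range x) = UNIV"
  shows "dyn_lex_greater x \<Omega> f g \<longleftrightarrow>
     (\<exists>n. (\<forall>m<n. f (x m) = g (x m)) \<and>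
        (f (x n) > g (x n) \<and> \<Omega> n = Positive \<or> f (x n) < g (x n) \<and> \<Omega> n = Negative))"
    (is "_ \<longleftrightarrow> (\<exists>n. ?P n)")
proof
  assume L: "dyn_lex_greater x \<Omega> f g"
  let ?n = "LEAST n. f (x n) \<noteq> g (x n)"
  have "\<forall>m<?n. f (x m) = g (x m)"
    using not_less_Least by blast
  with L have "?P ?n"
    unfolding dyn_lex_greater_def Let_def by blast
  then show "\<exists>n. ?P n" ..
next
  assume "\<exists>n. ?P n"
  then obtain n where n: "?P n" ..
  then have ne: "f (x n) \<noteq> g (x n)" by auto
  have "(LEAST n. f (x n) \<noteq> g (x n)) = n"
  proof (rule Least_equality)
    show "n \<le> m" if "f (x m) \<noteq> g (x m)" for m
      using n that by (meson not_less)
  qed (rule ne)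
  moreover have "f \<noteq> g" using ne by auto
  ultimately show "dyn_lex_greater x \<Omega> f g"
    using n by (simp only: dyn_lex_greater_def Let_def) blast
qed

lemma dyn_lex_ordering_left_ordering:
  assumes x: "closure (range x) = UNIV"
  shows "dyn_lex_ordering x \<Omega> \<in> left_orderings Homeo_plus"
proof -
  let ?H = "carrier Homeo_plus" and ?r = "dyn_lex_ordering x \<Omega>"
  note alt = dyn_lex_greater_alt[OF _ _ x, where \<Omega> = \<Omega>]
  have anti: False
    if asm: "f \<in> ?H" "g \<in> ?H" "dyn_lex_greater x \<Omega> f g" "dyn_lex_greater x \<Omega> g f" for f g
  proof -
    obtain n where n: "\<forall>m<n. f (x m) = g (x m)"
      "f (x n) > g (x n) \<and> \<Omega> n = Positive \<or> f (x n) < g (x n) \<and> \<Omega> n = Negative"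
      using asm(3) unfolding alt[OF asm(1,2)] by (elim exE conjE)
    obtain k where k: "\<forall>m<k. g (x m) = f (x m)"
      "g (x k) > f (x k) \<and> \<Omega> k = Positive \<or> g (x k) < f (x k) \<and> \<Omega> k = Negative"
      using asm(4) unfolding alt[OF asm(2,1)] by (elim exE conjE)
    have "f (x n) \<noteq> g (x n)" "g (x k) \<noteq> f (x k)" using n(2) k(2) by auto
    then have "\<not> n < k" "\<not> k < n" using n(1) k(1) by metis+
    then have "n = k" by simp
    with n(2) k(2) show False by auto
  qed
  have trans: "dyn_lex_greater x \<Omega> f h"
    if asm: "f \<in> ?H" "g \<in> ?H" "h \<in> ?H" "dyn_lex_greater x \<Omega> f g" "dyn_lex_greater x \<Omega> g h" for f g h
  proof -
    obtain n where n: "\<forall>m<n. f (x m) = g (x m)"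
      "f (x n) > g (x n) \<and> \<Omega> n = Positive \<or> f (x n) < g (x n) \<and> \<Omega> n = Negative"
      using asm(4) unfolding alt[OF asm(1,2)] by (elim exE conjE)
    obtain k where k: "\<forall>m<k. g (x m) = h (x m)"
      "g (x k) > h (x k) \<and> \<Omega> k = Positive \<or> g (x k) < h (x k) \<and> \<Omega> k = Negative"
      using asm(5) unfolding alt[OF asm(2,3)] by (elim exE conjE)
    have "(\<forall>m<min n k. f (x m) = h (x m)) \<and>
      (f (x (min n k)) > h (x (min n k)) \<and> \<Omega> (min n k) = Positive \<or>
       f (x (min n k)) < h (x (min n k)) \<and> \<Omega> (min n k) = Negative)"
      using n k by (cases n k rule: linorder_cases) auto
    then show ?thesis
      unfolding alt[OF asm(1,3)] by (rule exI)
  qed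
  have total: "dyn_lex_greater x \<Omega> f g \<or> dyn_lex_greater x \<Omega> g f"
    if asm: "f \<in> ?H" "g \<in> ?H" "f \<noteq> g" for f g
  proof -
    have "\<exists>n. f (x n) \<noteq> g (x n)"
      using Homeo_plus_eq_on_dense[OF asm(1,2) x] asm(3) by blast
    then obtain n where n: "f (x n) \<noteq> g (x n)" "\<forall>m<n. f (x m) = g (x m)"
      using exists_least_iff[of "\<lambda>n. f (x n) \<noteq> g (x n)"] by blast
    then have n': "\<forall>m<n. g (x m) = f (x m)" by simp
    have "f (x n) < g (x n) \<or> g (x n) < f (x n)"
      using n(1) by linarith
    moreover have "\<Omega> n = Positive \<or> \<Omega> n = Negative"
      by (cases "\<Omega> n") simp_all
    ultimately show ?thesis
      unfolding alt[OF asm(1,2)] alt[OF asm(2,1)] using n(2) n' by blast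
  qed
  have "linear_order_on ?H ?r"
    unfolding linear_order_on_def partial_order_on_def preorder_on_def
  proof (intro conjI)
    show "trans ?r"
      unfolding trans_def dyn_lex_ordering_def using trans by blast
    show "antisym ?r"
      unfolding antisym_def dyn_lex_ordering_def using anti by blast
    show "total_on ?H ?r"
      unfolding total_on_def dyn_lex_ordering_def using total by blast
  qed (auto simp: refl_on_def dyn_lex_ordering_def)
  moreover have "strictly_below ?r (h \<circ> f) (h \<circ> g)"
    if H: "f \<in> ?H" "g \<in> ?H" "h \<in> ?H" and s: "strictly_below ?r f g" for f g h
  proof -
    have hf: "h \<circ> f \<in> ?H" "h \<circ> g \<in> ?H"
      using monoid.m_closed[OF group.is_monoid[OF group_Homeo_plus] H(3,1)]
        monoid.m_closed[OF group.is_monoid[OF group_Homeo_plus] H(3,2)]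
      by simp_all
    have h: "strict_mono h" using H by (simp add: carrier_Homeo_plus)
    have "dyn_lex_greater x \<Omega> g f"
      using s by (auto simp: strictly_below_def dyn_lex_ordering_def)
    then have "dyn_lex_greater x \<Omega> (h \<circ> g) (h \<circ> f)"
      unfolding alt[OF hf(2,1)] alt[OF H(2,1)]
      by (simp only: comp_apply strict_mono_less[OF h] strict_mono_eq[OF h])
    moreover from this have "h \<circ> f \<noteq> h \<circ> g"
      unfolding dyn_lex_greater_def by metis
    ultimately show ?thesis
      using hf unfolding strictly_below_def dyn_lex_ordering_def by blast
  qed
  ultimately show ?thesis
    unfolding left_orderings_def mem_Collect_eq mult_Homeo_plus by blast
qed

lemma standard_dyn_lex_orderings_subset:
  "standard_dyn_lex_orderings \<subseteq> left_orderings Homeo_plus"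
  unfolding standard_dyn_lex_orderings_def using dyn_lex_ordering_left_ordering by blast


section \<open>Typical orderings\<close>

definition above_set :: "(real \<Rightarrow> real) \<Rightarrow> real set" where
  "above_set f = {x. f x > x}"

definition below_set :: "(real \<Rightarrow> real) \<Rightarrow> real set" where
  "below_set f = {x. f x < x}"

definition same_sign :: "('a, 'm) monoid_scheme \<Rightarrow> 'a rel \<Rightarrow> 'a \<Rightarrow> 'a \<Rightarrow> bool" where
  "same_sign G r f g \<longleftrightarrow>
     (positive_elem G r f \<and> positive_elem G r g) \<or>
     (negative_elem G r f \<and> negative_elem G r g) \<or>
     (f = \<one>\<^bsub>G\<^esub> \<and> g = \<one>\<^bsub>G\<^esub>)"

definition typical_orderings :: "(real \<Rightarrow> real) rel set" where
  "typical_orderings =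
     {r \<in> left_orderings Homeo_plus.
        \<forall>f\<in>carrier Homeo_plus. \<forall>g\<in>carrier Homeo_plus.
          above_set f = above_set g \<and> below_set f = below_set g \<longrightarrow> same_sign Homeo_plus r f g}"

end

theory Submission
  imports Defs
begin

text \<open>
  Call the pair of open sets on which \<open>f\<close> moves points up and down the type of \<open>f\<close>, so that an
  ordering is typical when the sign of an element only depends on its type. A standard
  dynamical-lexicographic ordering is typical, since the first \<open>x n\<close> moved by \<open>f\<close> and the
  direction of the move can be read off from the type. Signs vary continuously with the ordering,
  so the typical orderings form a closed set, and one inclusion follows.

  For the other inclusion, let finitely many elements be positive in a typical ordering \<open>r\<close>. The
  points and signs of a dynamical-lexicographic ordering that makes all of them positive can be
  chosen greedily, as long as some point is moved by one of the elements and all the elements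
  that move it do so in the same direction: take this point first, and go on with those elements
  that fix it. The heart of the proof is that such a point always exists
  (\<open>exists_unanimously_moved_point\<close>).

  Suppose that there is none. Choose bounded Lipschitz functions \<open>a f\<close> and \<open>b f\<close> which are
  positive exactly on the sets where \<open>f\<close> moves points up and down, respectively. Let \<open>P\<close> be the
  sum of all the \<open>a f\<close>, and \<open>N\<close> the sum of all the \<open>b f\<close>. By assumption both are positive wherever
  some element moves a point. So \<open>w f = a f * N - b f * P\<close> has the sign of \<open>f x - x\<close> at every \<open>x\<close>,
  and all the \<open>w f\<close> add up to \<open>P * N - N * P = 0\<close>. Each small multiple \<open>\<epsilon> * w f\<close> gives a
  homeomorphism \<open>x \<mapsto> x + \<epsilon> * w f x\<close> of the type of \<open>f\<close>, which is thus positive.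

  Positivity passes from perturbations \<open>u\<close>, \<open>v\<close> of the identity to \<open>u + v\<close>
  (\<open>positive_add_perturbations\<close>). Indeed, \<open>x \<mapsto> x + (u x + v x)\<close> has the type of the product of
  the inverse of \<open>x \<mapsto> x - u x\<close>, which has the type of \<open>x \<mapsto> x + u x\<close>, with \<open>x \<mapsto> x + v x\<close>.
  Summing over all the elements makes the identity positive, a contradiction.
\<close>

section \<open>Signs in a left-ordered group\<close>

lemma left_ordering_positiveD:
  assumes "r \<in> left_orderings G" "positive_elem G r f"
  shows "\<not> negative_elem G r f" "f \<noteq> \<one>\<^bsub>G\<^esub>" "f \<in> carrier G"
  using assms
  unfolding left_orderings_def positive_elem_def negative_elem_def strictly_below_def
    linear_order_on_def partial_order_on_def preorder_on_def antisym_def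
  by auto

lemma left_ordering_signs:
  assumes "r \<in> left_orderings G" "f \<in> carrier G" "\<one>\<^bsub>G\<^esub> \<in> carrier G" "f \<noteq> \<one>\<^bsub>G\<^esub>"
  shows "positive_elem G r f \<or> negative_elem G r f"
  using assms
  unfolding left_orderings_def positive_elem_def negative_elem_def strictly_below_def
    linear_order_on_def total_on_def
  by auto

lemma (in group) positive_mult:
  assumes r: "r \<in> left_orderings G" and f: "positive_elem G r f" and g: "positive_elem G r g"
  shows "positive_elem G r (f \<otimes> g)"
proof -
  have "f \<in> carrier G" "g \<in> carrier G"
    using left_ordering_positiveD(3)[OF r] f g by auto
  then have "strictly_below r (f \<otimes> \<one>) (f \<otimes> g)"
    using r g unfolding left_orderings_def positive_elem_def by blast
  then have "strictly_below r f (f \<otimes> g)"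
    using \<open>f \<in> carrier G\<close> by simp
  moreover have "trans r" "antisym r"
    using r unfolding left_orderings_def linear_order_on_def partial_order_on_def preorder_on_def
    by auto
  ultimately show ?thesis
    using f unfolding positive_elem_def strictly_below_def
    by (metis antisym_def transE)
qed

lemma (in group) positive_inv_iff:
  assumes r: "r \<in> left_orderings G" and f: "f \<in> carrier G"
  shows "positive_elem G r (inv f) \<longleftrightarrow> negative_elem G r f"
proof
  assume "positive_elem G r (inv f)"
  then have "strictly_below r (f \<otimes> \<one>) (f \<otimes> inv f)"
    using r f unfolding left_orderings_def positive_elem_def by blast
  then show "negative_elem G r f"
    using f by (simp add: negative_elem_def)
next
  assume "negative_elem G r f"
  then have "strictly_below r (inv f \<otimes> f) (inv f \<otimes> \<one>)"
    using r f inv_closed unfolding left_orderings_def negative_elem_def by blast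
  then show "positive_elem G r (inv f)"
    using f by (simp add: positive_elem_def)
qed

text \<open>
  The sets of the given subbasis are closed under finite intersections, so they form a basis.
\<close>

lemma LO_topology_basis:
  assumes "openin (LO_topology G) T" "r \<in> T"
  obtains S where "S \<subseteq> carrier G" "finite S" "r \<in> orderings_positive_on G S"
    "orderings_positive_on G S \<subseteq> T"
proof -
  let ?P = "\<lambda>T. \<forall>r\<in>T. \<exists>S. S \<subseteq> carrier G \<and> finite S \<and> r \<in> orderings_positive_on G S \<and>
    orderings_positive_on G S \<subseteq> T"
  have "generate_topology_on {orderings_positive_on G S | S. S \<subseteq> carrier G \<and> finite S} T"
    using assms(1) unfolding LO_topology_def by (rule openin_topology_generated_by)
  then have "?P T"
  proof induction
    case (Int a b)
    show ?case
    proof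
      fix r assume "r \<in> a \<inter> b"
      then obtain S S' where "S \<subseteq> carrier G" "finite S" "r \<in> orderings_positive_on G S"
        "orderings_positive_on G S \<subseteq> a" "S' \<subseteq> carrier G" "finite S'"
        "r \<in> orderings_positive_on G S'" "orderings_positive_on G S' \<subseteq> b"
        using Int.IH by (metis IntD1 IntD2)
      moreover have "orderings_positive_on G (S \<union> S') =
        orderings_positive_on G S \<inter> orderings_positive_on G S'"
        by (auto simp: orderings_positive_on_def)
      ultimately show "\<exists>S. S \<subseteq> carrier G \<and> finite S \<and> r \<in> orderings_positive_on G S \<and>
          orderings_positive_on G S \<subseteq> a \<inter> b"
        by (intro exI[of _ "S \<union> S'"]) auto
    qed
  next
    case (UN K)
    then show ?case by (meson UnionE Union_upper subset_trans)
  qed auto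
  with assms(2) that show ?thesis by blast
qed

lemma openin_orderings_positive_on:
  assumes "S \<subseteq> carrier G" "finite S"
  shows "openin (LO_topology G) (orderings_positive_on G S)"
  unfolding LO_topology_def using assms by (intro topology_generated_by_Basis) blast


section \<open>The typical orderings form a closed set\<close>

lemma inv_Homeo_plus:
  assumes "f \<in> carrier Homeo_plus"
  shows "inv\<^bsub>Homeo_plus\<^esub> f \<in> carrier Homeo_plus" "f ((inv\<^bsub>Homeo_plus\<^esub> f) x) = x"
  using group.inv_closed[OF group_Homeo_plus assms] group.r_inv[OF group_Homeo_plus assms]
  by (auto simp: fun_eq_iff)

lemma id_in_Homeo_plus: "id \<in> carrier Homeo_plus"
  using monoid.one_closed[OF group.is_monoid[OF group_Homeo_plus]] by simp

lemma typicalD: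
  assumes "r \<in> typical_orderings" "positive_elem Homeo_plus r f"
    and "g \<in> carrier Homeo_plus" "above_set f = above_set g" "below_set f = below_set g"
  shows "positive_elem Homeo_plus r g"
proof -
  have "r \<in> left_orderings Homeo_plus"
    using assms(1) by (simp add: typical_orderings_def)
  note f = left_ordering_positiveD[OF this assms(2)]
  have "same_sign Homeo_plus r f g"
    using assms(1,3-) f(3) by (simp add: typical_orderings_def)
  with f show ?thesis by (auto simp: same_sign_def)
qed

text \<open>
  The identity is the only element of its type, and every other element is positive or negative.
  So only opposite signs of two elements of the same type have to be excluded.
\<close>

lemma typicalI:
  assumes r: "r \<in> left_orderings Homeo_plus"
    and *: "\<And>f g. f \<in> carrier Homeo_plus \<Longrightarrow> g \<in> carrier Homeo_plus \<Longrightarrow>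
      above_set f = above_set g \<Longrightarrow> below_set f = below_set g \<Longrightarrow>
      positive_elem Homeo_plus r f \<Longrightarrow> negative_elem Homeo_plus r g \<Longrightarrow> False"
  shows "r \<in> typical_orderings"
  unfolding typical_orderings_def
proof (intro CollectI conjI ballI impI r)
  fix f g assume fg: "f \<in> carrier Homeo_plus" "g \<in> carrier Homeo_plus"
    and ab: "above_set f = above_set g \<and> below_set f = below_set g"
  have "h = id \<longleftrightarrow> above_set h = {} \<and> below_set h = {}" for h
    by (auto simp: above_set_def below_set_def fun_eq_iff) (metis linorder_neq_iff)
  with ab have "f = id \<longleftrightarrow> g = id" by metis
  moreover have "positive_elem Homeo_plus r h \<or> negative_elem Homeo_plus r h"
    if "h \<in> carrier Homeo_plus" "h \<noteq> id" for h
    using left_ordering_signs[OF r that(1)] that(2) id_in_Homeo_plus by simp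
  ultimately show "same_sign Homeo_plus r f g"
    using *[OF fg] *[OF fg(2,1)] ab fg unfolding same_sign_def one_Homeo_plus by metis
qed

lemma dyn_lex_greater_id_cong:
  assumes "f \<in> carrier Homeo_plus" "g \<in> carrier Homeo_plus" "closure (range x) = UNIV"
    and "above_set f = above_set g" "below_set f = below_set g"
  shows "dyn_lex_greater x \<Omega> f id \<longleftrightarrow> dyn_lex_greater x \<Omega> g id"
proof -
  have "f y > y \<longleftrightarrow> g y > y" "f y < y \<longleftrightarrow> g y < y" for y
    using assms(4,5) by (auto simp: above_set_def below_set_def)
  moreover from this have "f y = y \<longleftrightarrow> g y = y" for y
    by (metis linorder_neq_iff)
  ultimately show ?thesis
    using assms(1-3) by (simp add: dyn_lex_greater_alt id_in_Homeo_plus)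
qed

lemma positive_dyn_lex_iff:
  assumes "f \<in> carrier Homeo_plus"
  shows "positive_elem Homeo_plus (dyn_lex_ordering x \<Omega>) f \<longleftrightarrow> dyn_lex_greater x \<Omega> f id"
proof -
  have "dyn_lex_greater x \<Omega> f id \<Longrightarrow> f \<noteq> id"
    by (metis dyn_lex_greater_def)
  then show ?thesis
    using assms id_in_Homeo_plus
    by (auto simp: positive_elem_def strictly_below_def dyn_lex_ordering_def)
qed

lemma standard_subset_typical: "standard_dyn_lex_orderings \<subseteq> typical_orderings"
proof
  fix r assume "r \<in> standard_dyn_lex_orderings"
  then obtain x \<Omega> where r: "r = dyn_lex_ordering x \<Omega>" and x: "closure (range x) = UNIV"
    by (auto simp: standard_dyn_lex_orderings_def)
  have lo: "r \<in> left_orderings Homeo_plus"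
    unfolding r using x by (rule dyn_lex_ordering_left_ordering)
  show "r \<in> typical_orderings"
  proof (rule typicalI[OF lo])
    fix f g assume f: "f \<in> carrier Homeo_plus" and g: "g \<in> carrier Homeo_plus"
      and ab: "above_set f = above_set g" "below_set f = below_set g"
      and pf: "positive_elem Homeo_plus r f" and ng: "negative_elem Homeo_plus r g"
    have "dyn_lex_greater x \<Omega> f id"
      using pf unfolding r positive_dyn_lex_iff[OF f] .
    then have "positive_elem Homeo_plus r g"
      unfolding r positive_dyn_lex_iff[OF g] dyn_lex_greater_id_cong[OF f g x ab] .
    with left_ordering_positiveD(1)[OF lo] ng show False by blast
  qed
qed

text \<open>
  If \<open>f\<close> is positive and \<open>g\<close> negative, then so they are in the neighbourhood of all orderings in
  which \<open>f\<close> and the inverse of \<open>g\<close> are positive.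
\<close>

lemma closedin_typical: "closedin (LO_topology Homeo_plus) typical_orderings"
proof -
  have "r \<in> typical_orderings"
    if cl: "r \<in> LO_topology Homeo_plus closure_of typical_orderings" for r
  proof -
    from cl have r: "r \<in> left_orderings Homeo_plus"
      by (simp add: in_closure_of)
    show ?thesis
    proof (rule typicalI[OF r])
      fix f g assume f: "f \<in> carrier Homeo_plus" and g: "g \<in> carrier Homeo_plus"
        and ab: "above_set f = above_set g" "below_set f = below_set g"
        and pf: "positive_elem Homeo_plus r f" and ng: "negative_elem Homeo_plus r g"
      let ?S = "{f, inv\<^bsub>Homeo_plus\<^esub> g}"
      note inv_iff = group.positive_inv_iff[OF group_Homeo_plus _ g]
      have "openin (LO_topology Homeo_plus) (orderings_positive_on Homeo_plus ?S)"
        by (rule openin_orderings_positive_on) (use f inv_Homeo_plus[OF g] in auto)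
      moreover have "r \<in> orderings_positive_on Homeo_plus ?S"
        using r pf ng inv_iff[OF r] by (simp add: orderings_positive_on_def)
      ultimately obtain s where s: "s \<in> typical_orderings" "s \<in> orderings_positive_on Homeo_plus ?S"
        using cl by (auto simp: in_closure_of)
      then have sl: "s \<in> left_orderings Homeo_plus" and "positive_elem Homeo_plus s f"
        and "negative_elem Homeo_plus s g"
        using inv_iff by (auto simp: orderings_positive_on_def)
      moreover from this have "positive_elem Homeo_plus s g"
        using typicalD[OF s(1) _ g] ab by blast
      ultimately show False
        using left_ordering_positiveD(1)[OF sl] by blast
    qed
  qed
  moreover have "typical_orderings \<subseteq> topspace (LO_topology Homeo_plus)"
    by (auto simp: typical_orderings_def)
  ultimately show ?thesis
    using closure_of_subset_eq by blast
qed


section \<open>Lipschitz perturbations of the identity\<close>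

text \<open>
  The equation \<open>x + u x = y\<close> says that \<open>x\<close> is a fixed point of the contraction \<open>x \<mapsto> y - u x\<close>, so
  it has a solution. Continuity, also of the inverse, then follows from monotonicity.
\<close>

lemma perturbation_in_Homeo_plus:
  fixes u :: "real \<Rightarrow> real"
  assumes u: "L-lipschitz_on UNIV u" and L: "L < 1"
  shows "(\<lambda>x. x + u x) \<in> carrier Homeo_plus"
proof -
  let ?f = "\<lambda>x. x + u x"
  have L0: "0 \<le> L" using u by (rule lipschitz_on_nonneg)
  have mono: "strict_mono ?f"
  proof (rule strict_monoI)
    fix x y :: real assume "x < y"
    have "\<bar>u x - u y\<bar> \<le> L * \<bar>x - y\<bar>"
      using lipschitz_onD[OF u, of x y] by (simp add: dist_real_def)
    moreover have "L * \<bar>x - y\<bar> < 1 * \<bar>x - y\<bar>"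
      using L \<open>x < y\<close> by (intro mult_strict_right_mono) auto
    ultimately have "\<bar>u x - u y\<bar> < \<bar>x - y\<bar>" by simp
    then show "?f x < ?f y" using \<open>x < y\<close> by linarith
  qed
  have surj: "surj ?f"
  proof (rule surjI)
    fix y
    have "\<exists>!x. y - u x = x"
      by (rule banach_fix_type[OF L0 L])
        (use lipschitz_onD[OF u] in \<open>auto simp: dist_real_def abs_minus_commute\<close>)
    then have "y - u (SOME x. y - u x = x) = (SOME x. y - u x = x)"
      by (metis (mono_tags, lifting) someI_ex)
    then show "?f (SOME x. y - u x = x) = y" by linarith
  qed
  have inj: "inj ?f" using mono by (rule strict_mono_imp_inj_on)
  define g where "g = inv_into UNIV ?f"
  have fg: "?f (g y) = y" and gf: "g (?f x) = x" for x y
    unfolding g_def using surj_f_inv_f[OF surj, of y] inv_f_f[OF inj, of x] by auto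
  have "strict_mono g"
    by (rule strict_mono_inv[OF mono surj gf])
  moreover have "range g = UNIV"
    by (rule surjI) (rule gf)
  ultimately have "continuous_on UNIV g"
    by (intro continuous_onI_mono) (auto simp: strict_mono_less_eq)
  moreover have "continuous_on UNIV ?f"
    by (intro continuous_intros lipschitz_on_continuous_on[OF u])
  ultimately have "homeomorphism UNIV UNIV ?f g"
    using surj \<open>range g = UNIV\<close> fg gf unfolding homeomorphism_def by auto
  with mono show ?thesis by (auto simp: carrier_Homeo_plus)
qed

lemma above_set_perturbation: "above_set (\<lambda>x. x + u x) = {x. u x > 0}"
  and below_set_perturbation: "below_set (\<lambda>x. x + u x) = {x. u x < 0}"
  by (auto simp: above_set_def below_set_def)

text \<open>
  The inverse \<open>h'\<close> of \<open>x \<mapsto> x - u x\<close> moves a point up exactly where \<open>u\<close> is positive, so it has the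
  same type as \<open>x \<mapsto> x + u x\<close>. The product \<open>h' \<circ> g\<close> with \<open>g x = x + v x\<close> moves \<open>x\<close> up exactly if
  \<open>x + v x > x - u x\<close>. In this way a composition of homeomorphisms is turned into a pointwise sum.
\<close>

lemma positive_add_perturbations:
  assumes r: "r \<in> typical_orderings"
    and u: "K-lipschitz_on UNIV u" and v: "L-lipschitz_on UNIV v" and KL: "K + L < 1"
    and pu: "positive_elem Homeo_plus r (\<lambda>x. x + u x)"
    and pv: "positive_elem Homeo_plus r (\<lambda>x. x + v x)"
  shows "positive_elem Homeo_plus r (\<lambda>x. x + (u x + v x))"
proof -
  have lo: "r \<in> left_orderings Homeo_plus"
    using r by (simp add: typical_orderings_def)
  have K: "K < 1"
    using lipschitz_on_nonneg[OF v] KL by linarith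
  define h where "h = (\<lambda>x. x - u x)"
  define h' where "h' = inv\<^bsub>Homeo_plus\<^esub> h"
  have h: "h \<in> carrier Homeo_plus"
    using perturbation_in_Homeo_plus[of K "\<lambda>x. - u x"] u K by (simp add: h_def)
  note h' = inv_Homeo_plus[OF h, folded h'_def]
  have less: "h' y > x \<longleftrightarrow> y > h x" "h' y < x \<longleftrightarrow> y < h x" for x y
    using h strict_mono_less[of h x "h' y"] strict_mono_less[of h "h' y" x]
    by (simp_all add: carrier_Homeo_plus h'(2))
  have "positive_elem Homeo_plus r h'"
    by (rule typicalD[OF r pu h'(1)])
      (auto simp: above_set_def below_set_def less, auto simp: h_def)
  then have "positive_elem Homeo_plus r (h' \<circ> (\<lambda>x. x + v x))"
    using group.positive_mult[OF group_Homeo_plus lo _ pv] by simp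
  then show ?thesis
  proof (rule typicalD[OF r])
    show "(\<lambda>x. x + (u x + v x)) \<in> carrier Homeo_plus"
      by (rule perturbation_in_Homeo_plus[OF lipschitz_on_add[OF u v] KL])
  qed (auto simp: above_set_def below_set_def less, auto simp: h_def)
qed

lemma lipschitz_on_sum:
  fixes u :: "'i \<Rightarrow> 'a::metric_space \<Rightarrow> 'b::real_normed_vector"
  assumes "\<And>i. i \<in> I \<Longrightarrow> (C i)-lipschitz_on U (u i)"
  shows "(\<Sum>i\<in>I. C i)-lipschitz_on U (\<lambda>x. \<Sum>i\<in>I. u i x)"
  using assms
  by (induction I rule: infinite_finite_induct)
    (auto intro: lipschitz_on_add lipschitz_on_constant)

lemma positive_sum_perturbations:
  assumes r: "r \<in> typical_orderings" and I: "finite I" "I \<noteq> {}"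
    and "\<And>i. i \<in> I \<Longrightarrow> (C i)-lipschitz_on UNIV (u i)" "(\<Sum>i\<in>I. C i) < 1"
    and "\<And>i. i \<in> I \<Longrightarrow> positive_elem Homeo_plus r (\<lambda>x. x + u i x)"
  shows "positive_elem Homeo_plus r (\<lambda>x. x + (\<Sum>i\<in>I. u i x))"
  using I assms(4-)
proof (induction I rule: finite_ne_induct)
  case (insert i I)
  have "0 \<le> C i"
    using insert.prems(1)[of i] by (simp add: lipschitz_on_nonneg)
  moreover have sum: "C i + (\<Sum>i\<in>I. C i) < 1"
    using insert.prems(2) insert.hyps by simp
  ultimately have "positive_elem Homeo_plus r (\<lambda>x. x + (\<Sum>i\<in>I. u i x))"
    by (intro insert.IH insert.prems) auto
  then have "positive_elem Homeo_plus r (\<lambda>x. x + (u i x + (\<Sum>i\<in>I. u i x)))"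
    by (intro positive_add_perturbations[OF r _ _ sum] lipschitz_on_sum insert.prems) auto
  then show ?case using insert.hyps by simp
qed simp


section \<open>A point moved in one direction only\<close>

lemma lipschitz_on_mult_bounded:
  fixes f g :: "'a::metric_space \<Rightarrow> real"
  assumes f: "K-lipschitz_on U f" and g: "L-lipschitz_on U g"
    and B: "\<And>x. x \<in> U \<Longrightarrow> \<bar>f x\<bar> \<le> B" and C: "\<And>x. x \<in> U \<Longrightarrow> \<bar>g x\<bar> \<le> C"
    and "0 \<le> B" "0 \<le> C"
  shows "(K * C + B * L)-lipschitz_on U (\<lambda>x. f x * g x)"
proof (rule lipschitz_onI)
  have KL: "0 \<le> K" "0 \<le> L"
    using f g by (auto dest: lipschitz_on_nonneg)
  then show "0 \<le> K * C + B * L" using assms by simp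
  fix x y assume xy: "x \<in> U" "y \<in> U"
  have "\<bar>f x * g x - f y * g y\<bar> = \<bar>(f x - f y) * g x + f y * (g x - g y)\<bar>"
    by (simp add: algebra_simps)
  also have "\<dots> \<le> \<bar>f x - f y\<bar> * \<bar>g x\<bar> + \<bar>f y\<bar> * \<bar>g x - g y\<bar>"
    by (metis abs_mult abs_triangle_ineq)
  also have "\<dots> \<le> (K * dist x y) * C + B * (L * dist x y)"
    using lipschitz_onD[OF f xy] lipschitz_onD[OF g xy] B[OF xy(2)] C[OF xy(1)] KL \<open>0 \<le> B\<close>
    by (intro add_mono mult_mono) (auto simp: dist_real_def)
  finally show "dist (f x * g x) (f y * g y) \<le> (K * C + B * L) * dist x y"
    by (simp add: dist_real_def algebra_simps)
qed

lemma exists_lipschitz_bump: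
  fixes A :: "'a::metric_space set"
  assumes "open A"
  shows "\<exists>a::'a \<Rightarrow> real. 1-lipschitz_on UNIV a \<and> (\<forall>x. 0 \<le> a x \<and> a x \<le> 1 \<and> (a x > 0 \<longleftrightarrow> x \<in> A))"
proof (cases "A = UNIV")
  \<comment> \<open>Here the distance to the complement is of no use: \<open>infdist x {} = 0\<close>.\<close>
  case True
  have "1-lipschitz_on UNIV (\<lambda>x::'a. 1::real)"
    by (rule lipschitz_onI) auto
  with True show ?thesis by (intro exI[of _ "\<lambda>x. 1"]) simp
next
  case False
  let ?a = "\<lambda>x. min 1 (infdist x (- A))"
  have "infdist x (- A) = 0 \<longleftrightarrow> x \<notin> A" for x
    using in_closed_iff_infdist_zero[of "- A" x] assms False by (auto simp: closed_def)
  then have "infdist x (- A) > 0 \<longleftrightarrow> x \<in> A" for x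
    using infdist_nonneg[of x "- A"] by (metis order_less_le)
  then have "?a x > 0 \<longleftrightarrow> x \<in> A" for x
    by simp
  moreover have "1-lipschitz_on UNIV ?a"
  proof (rule lipschitz_onI)
    fix x y
    have "\<bar>infdist x (- A) - infdist y (- A)\<bar> \<le> dist x y"
      by (rule infdist_triangle_abs)
    then show "dist (?a x) (?a y) \<le> 1 * dist x y"
      by (auto simp: dist_real_def min_def)
  qed simp
  ultimately show ?thesis
    by (intro exI[of _ ?a]) (auto simp: infdist_nonneg)
qed

lemma open_above_below_set:
  assumes "f \<in> carrier Homeo_plus"
  shows "open (above_set f)" "open (below_set f)"
proof -
  have "continuous_on UNIV f"
    using assms by (auto simp: carrier_Homeo_plus homeomorphism_def)
  then show "open (above_set f)" "open (below_set f)"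
    unfolding above_set_def below_set_def by (intro open_Collect_less continuous_intros; simp)+
qed

text \<open>
  Otherwise, weights \<open>N\<close> and \<open>P\<close> for the upward and downward parts make perturbations of the types
  of the given elements cancel. Multiplying with the total of the opposite direction, rather than
  dividing by the total of the same direction, keeps everything Lipschitz up to the boundary of
  the set of moved points.
\<close>

lemma exists_unanimously_moved_point:
  assumes r: "r \<in> typical_orderings" and F: "finite F" "F \<noteq> {}"
    and pos: "\<And>f. f \<in> F \<Longrightarrow> positive_elem Homeo_plus r f"
  shows "\<exists>p. (\<exists>f\<in>F. f p \<noteq> p) \<and> ((\<forall>f\<in>F. f p \<ge> p) \<or> (\<forall>f\<in>F. f p \<le> p))"
proof (rule ccontr)
  assume no: "\<not> ?thesis"
  have lo: "r \<in> left_orderings Homeo_plus"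
    using r by (simp add: typical_orderings_def)
  note open_type = open_above_below_set[OF left_ordering_positiveD(3)[OF lo pos]]
  have "\<forall>f\<in>F. \<exists>a. 1-lipschitz_on UNIV a \<and>
      (\<forall>x. 0 \<le> a x \<and> a x \<le> 1 \<and> (a x > (0::real) \<longleftrightarrow> x \<in> above_set f))"
    "\<forall>f\<in>F. \<exists>b. 1-lipschitz_on UNIV b \<and>
      (\<forall>x. 0 \<le> b x \<and> b x \<le> 1 \<and> (b x > (0::real) \<longleftrightarrow> x \<in> below_set f))"
    using exists_lipschitz_bump[OF open_type(1)] exists_lipschitz_bump[OF open_type(2)] by auto
  from this[THEN bchoice] obtain a b :: "(real \<Rightarrow> real) \<Rightarrow> real \<Rightarrow> real" where
    lip: "\<And>f. f \<in> F \<Longrightarrow> 1-lipschitz_on UNIV (a f)" "\<And>f. f \<in> F \<Longrightarrow> 1-lipschitz_on UNIV (b f)" and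
    a: "\<And>f x. f \<in> F \<Longrightarrow> 0 \<le> a f x \<and> a f x \<le> 1 \<and> (a f x > 0 \<longleftrightarrow> f x > x)" and
    b: "\<And>f x. f \<in> F \<Longrightarrow> 0 \<le> b f x \<and> b f x \<le> 1 \<and> (b f x > 0 \<longleftrightarrow> f x < x)"
    unfolding above_set_def below_set_def mem_Collect_eq by metis
  define P where "P x = (\<Sum>f\<in>F. a f x)" for x
  define N where "N x = (\<Sum>f\<in>F. b f x)" for x
  define w where "w f x = a f x * N x - b f x * P x" for f x
  have PN: "P x > 0" "N x > 0" if "f \<in> F" "f x \<noteq> x" for f x
  proof -
    have "\<exists>g\<in>F. g x > x" "\<exists>g\<in>F. g x < x"
      using no that by (meson not_le)+
    then show "P x > 0" "N x > 0"
      unfolding P_def N_def using a b F(1) by (meson sum_pos2)+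
  qed
  have wpos: "w f x > 0 \<longleftrightarrow> f x > x" and wneg: "w f x < 0 \<longleftrightarrow> f x < x" if f: "f \<in> F" for f x
  proof -
    \<comment> \<open>At most one of \<open>a f x\<close> and \<open>b f x\<close> is nonzero, and the factors \<open>N x\<close> and \<open>P x\<close> are positive
      if one of them is.\<close>
    have "a f x = 0" if "\<not> f x > x" using a[OF f, of x] that by auto
    moreover have "b f x = 0" if "\<not> f x < x" using b[OF f, of x] that by auto
    moreover have "a f x * N x > 0" if "f x > x" using a[OF f, of x] PN[OF f, of x] that by auto
    moreover have "b f x * P x > 0" if "f x < x" using b[OF f, of x] PN[OF f, of x] that by auto
    ultimately have "(f x > x \<longrightarrow> w f x > 0) \<and> (f x < x \<longrightarrow> w f x < 0) \<and> (f x = x \<longrightarrow> w f x = 0)"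
      by (auto simp: w_def)
    then show "w f x > 0 \<longleftrightarrow> f x > x" "w f x < 0 \<longleftrightarrow> f x < x"
      by (metis linorder_neq_iff order_less_asym)+
  qed
  define k where "k = real (card F)"
  have k: "k > 0" using F by (simp add: k_def card_gt_0_iff)
  have PNlip: "k-lipschitz_on UNIV P" "k-lipschitz_on UNIV N"
    using lipschitz_on_sum[of F "\<lambda>_. 1" UNIV a] lipschitz_on_sum[of F "\<lambda>_. 1" UNIV b] lip
    by (auto simp: P_def[abs_def] N_def[abs_def] k_def)
  have "0 \<le> P x" "P x \<le> k" "0 \<le> N x" "N x \<le> k" for x
    unfolding P_def N_def k_def
    using sum_bounded_above[of F "\<lambda>f. a f x" 1] sum_bounded_above[of F "\<lambda>f. b f x" 1] a b
    by (auto intro: sum_nonneg)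
  then have PNbound: "\<bar>P x\<bar> \<le> k" "\<bar>N x\<bar> \<le> k" for x
    by auto
  have wlip: "(4 * k)-lipschitz_on UNIV (w f)" if f: "f \<in> F" for f
  proof -
    have "\<bar>a f x\<bar> \<le> 1" "\<bar>b f x\<bar> \<le> 1" for x
      using a[OF f, of x] b[OF f, of x] by auto
    then have "(1 * k + 1 * k)-lipschitz_on UNIV (\<lambda>x. a f x * N x)"
      "(1 * k + 1 * k)-lipschitz_on UNIV (\<lambda>x. b f x * P x)"
      using k by (intro lipschitz_on_mult_bounded lip[OF f] PNlip PNbound; simp)+
    from lipschitz_on_diff[OF this] show ?thesis by (simp add: w_def[abs_def])
  qed
  \<comment> \<open>The \<open>k\<close> functions \<open>\<epsilon> * w f\<close> have Lipschitz constant \<open>\<epsilon> * (4 * k)\<close>; these constants must add up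
    to less than \<open>1\<close>.\<close>
  define \<epsilon> where "\<epsilon> = 1 / (8 * k * k)"
  have \<epsilon>: "\<epsilon> > 0" using k by (simp add: \<epsilon>_def)
  have "positive_elem Homeo_plus r (\<lambda>x. x + (\<Sum>f\<in>F. \<epsilon> * w f x))"
  proof (rule positive_sum_perturbations[OF r F])
    show elip: "(\<epsilon> * (4 * k))-lipschitz_on UNIV (\<lambda>x. \<epsilon> * w f x)" if "f \<in> F" for f
      using wlip[OF that] \<epsilon> by (intro lipschitz_on_cmult_real_nonneg) auto
    show "(\<Sum>f\<in>F. \<epsilon> * (4 * k)) < 1"
      using k by (simp add: \<epsilon>_def flip: k_def)
    fix f assume f: "f \<in> F"
    show "positive_elem Homeo_plus r (\<lambda>x. x + \<epsilon> * w f x)"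
    proof (rule typicalD[OF r pos[OF f]])
      have "k \<ge> 1" using F by (simp add: k_def Suc_le_eq card_gt_0_iff)
      then have "\<epsilon> * (4 * k) < 1" by (simp add: \<epsilon>_def)
      then show "(\<lambda>x. x + \<epsilon> * w f x) \<in> carrier Homeo_plus"
        by (rule perturbation_in_Homeo_plus[OF elip[OF f]])
    qed (use \<epsilon> wpos[OF f] wneg[OF f] in
        \<open>auto simp: above_set_def below_set_def zero_less_mult_iff mult_less_0_iff\<close>)
  qed
  moreover have "(\<Sum>f\<in>F. \<epsilon> * w f x) = 0" for x
    by (simp add: w_def sum_subtractf P_def N_def mult.commute flip: sum_distrib_left sum_distrib_right)
  ultimately have "positive_elem Homeo_plus r id"
    by (simp add: id_def)
  with left_ordering_positiveD(2)[OF lo] show False by auto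
qed


section \<open>Approximation by dynamical-lexicographic orderings\<close>

lemma exists_dense_sequence: "\<exists>x :: nat \<Rightarrow> real. closure (range x) = UNIV"
proof -
  have "(\<rat> :: real set) \<noteq> {}" using Rats_0 by blast
  then have "range (from_nat_into \<rat>) = (\<rat> :: real set)"
    using countable_rat by (intro range_from_nat_into) auto
  with Rats_closure_real show ?thesis by metis
qed

lemma dyn_lex_greater_case_nat:
  assumes f: "f \<in> carrier Homeo_plus" and g: "g \<in> carrier Homeo_plus"
    and x: "closure (range x) = UNIV" "closure (range (case_nat p x)) = UNIV"
    and s: "f p > g p \<and> s = Positive \<or> f p < g p \<and> s = Negative \<or>
      f p = g p \<and> dyn_lex_greater x \<Omega> f g"
  shows "dyn_lex_greater (case_nat p x) (case_nat s \<Omega>) f g"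
proof (cases "f p = g p")
  case True
  with s obtain n where n: "\<forall>m<n. f (x m) = g (x m)"
    "f (x n) > g (x n) \<and> \<Omega> n = Positive \<or> f (x n) < g (x n) \<and> \<Omega> n = Negative"
    using dyn_lex_greater_alt[OF f g x(1)] by auto
  with True show ?thesis
    unfolding dyn_lex_greater_alt[OF f g x(2)]
    by (intro exI[of _ "Suc n"]) (auto simp: less_Suc_eq_0_disj)
next
  case False
  with s show ?thesis
    unfolding dyn_lex_greater_alt[OF f g x(2)] by (intro exI[of _ 0]) auto
qed

text \<open>
  The induction is on \<open>F\<close>: a unanimously moved point \<open>p\<close>, with the sign that fits its direction,
  decides all the elements that move \<open>p\<close>, and the sequence for the elements that fix \<open>p\<close> is
  appended to it. This sequence is dense already, so no points have to be added in the end.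
\<close>

lemma finite_positive_set_realized_by_dyn_lex:
  assumes r: "r \<in> typical_orderings" and "finite F"
    and "\<And>f. f \<in> F \<Longrightarrow> positive_elem Homeo_plus r f"
  shows "\<exists>x \<Omega>. closure (range x) = UNIV \<and> (\<forall>f\<in>F. dyn_lex_greater x \<Omega> f id)"
  using assms(2,3)
proof (induction F rule: finite_psubset_induct)
  case (psubset F)
  show ?case
  proof (cases "F = {}")
    case True
    then show ?thesis using exists_dense_sequence by auto
  next
    case False
    obtain p where moved: "\<exists>f\<in>F. f p \<noteq> p" and dir: "(\<forall>f\<in>F. f p \<ge> p) \<or> (\<forall>f\<in>F. f p \<le> p)"
      using exists_unanimously_moved_point[OF r psubset.hyps False psubset.prems] by blast
    then obtain s where s: "\<forall>f\<in>F. f p > p \<and> s = Positive \<or> f p < p \<and> s = Negative \<or> f p = p"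
      by (metis linorder_neq_iff not_le)
    have "{f \<in> F. f p = p} \<subset> F" using moved by auto
    from psubset.IH[OF this] psubset.prems obtain x \<Omega>
      where x: "closure (range x) = UNIV" and \<Omega>: "\<forall>f\<in>{f \<in> F. f p = p}. dyn_lex_greater x \<Omega> f id"
      by (metis (no_types, lifting) mem_Collect_eq)
    have "range x \<subseteq> range (case_nat p x)"
      by (auto intro: range_eqI[of _ _ "Suc _"])
    then have x': "closure (range (case_nat p x)) = UNIV"
      using closure_mono x by blast
    have "r \<in> left_orderings Homeo_plus"
      using r by (simp add: typical_orderings_def)
    note carr = left_ordering_positiveD(3)[OF this psubset.prems]
    have "dyn_lex_greater (case_nat p x) (case_nat s \<Omega>) f id" if "f \<in> F" for f
      by (rule dyn_lex_greater_case_nat[OF carr[OF that] id_in_Homeo_plus x x'])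
        (use s \<Omega> that in auto)
    with x' show ?thesis by blast
  qed
qed

theorem theorem2:
  shows "LO_topology Homeo_plus closure_of standard_dyn_lex_orderings = typical_orderings"
proof
  show "LO_topology Homeo_plus closure_of standard_dyn_lex_orderings \<subseteq> typical_orderings"
    using standard_subset_typical closedin_typical by (rule closure_of_minimal)
  show "typical_orderings \<subseteq> LO_topology Homeo_plus closure_of standard_dyn_lex_orderings"
  proof
    fix r assume r: "r \<in> typical_orderings"
    have "\<exists>s. s \<in> standard_dyn_lex_orderings \<and> s \<in> T"
      if T: "openin (LO_topology Homeo_plus) T" "r \<in> T" for T
    proof -
      obtain F where F: "F \<subseteq> carrier Homeo_plus" "finite F"
        and rF: "r \<in> orderings_positive_on Homeo_plus F"
        and FT: "orderings_positive_on Homeo_plus F \<subseteq> T"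
        using LO_topology_basis[OF T] by blast
      obtain x \<Omega> where x: "closure (range x) = UNIV" and "\<forall>f\<in>F. dyn_lex_greater x \<Omega> f id"
        using finite_positive_set_realized_by_dyn_lex[OF r F(2)] rF
        by (auto simp: orderings_positive_on_def)
      then have "dyn_lex_ordering x \<Omega> \<in> orderings_positive_on Homeo_plus F"
        using F(1) dyn_lex_ordering_left_ordering[OF x] positive_dyn_lex_iff
        by (auto simp: orderings_positive_on_def)
      moreover have "dyn_lex_ordering x \<Omega> \<in> standard_dyn_lex_orderings"
        using x by (auto simp: standard_dyn_lex_orderings_def)
      ultimately show ?thesis using FT by blast
    qed
    moreover have "r \<in> left_orderings Homeo_plus"
      using r by (simp add: typical_orderings_def)
    ultimately show "r \<in> LO_topology Homeo_plus closure_of standard_dyn_lex_orderings"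
      by (simp add: in_closure_of)
  qed
qed

end
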